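(* Let $(X,\tau)$ be an extended locally convex space. Then $\tau$ is induced by the collection $\{\rho_A: A\subseteq X^*\text{ is equicontinuous on }(X,\tau)\}$ of extended seminorms, where $\rho_A(x)=\sup_{f\in A}|f(x)|$ for $x\in X$.
   Context: Vector spaces are over $\mathbb{K}$, where $\mathbb{K}$ is $\mathbb{R}$ or $\mathbb{C}$. An extended seminorm on $X$ is a map $\rho:X\to[0,\infty]$ with $\rho(\alpha x)=|\alpha|\rho(x)$ (convention $0\cdot\infty=0$) and $\rho(x+y)\le\rho(x)+\rho(y)$. An extended locally convex space (elcs) is a vector space $X$ with a group topology $\tau$ induced by a family $\{\rho_i\}_{i\in I}$ of extended seminorms, i.e. the sets $\{y:\rho_i(y-x)<\varepsilon \text{ for all } i\in J\}$ with $\varepsilon>0$ and $J\subseteq I$ finite form a neighborhood base at $x$. $X^*$ is the set of all $\tau$-continuous linear functionals $X\to\mathbb{K}$. A set $A\subseteq X^*$ is equicontinuous on $(X,\tau)$ if there is a $\tau$-neighborhood $U$ of $0$ such that $|f(x)|\le1$ for all $f\in A$, $x\in U$. *)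

theory Defs
  imports "HOL-Analysis.Analysis"
begin

definition extended_seminorm ::
    "('k::real_normed_field \<Rightarrow> 'a::ab_group_add \<Rightarrow> 'a) \<Rightarrow> ('a \<Rightarrow> ennreal) \<Rightarrow> bool" where
  "extended_seminorm smul \<rho> \<longleftrightarrow>
     (\<forall>\<alpha> x. \<rho> (smul \<alpha> x) = ennreal (norm \<alpha>) * \<rho> x) \<and>
     (\<forall>x y. \<rho> (x + y) \<le> \<rho> x + \<rho> y)"

(* Neighbourhoods need not be open. *)
definition nbhd :: "'a topology \<Rightarrow> 'a \<Rightarrow> 'a set \<Rightarrow> bool" where
  "nbhd \<tau> x U \<longleftrightarrow> U \<subseteq> topspace \<tau> \<and> (\<exists>V. openin \<tau> V \<and> x \<in> V \<and> V \<subseteq> U)"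

definition group_topology :: "'a::ab_group_add topology \<Rightarrow> bool" where
  "group_topology \<tau> \<longleftrightarrow>
     topspace \<tau> = UNIV \<and>
     continuous_map (prod_topology \<tau> \<tau>) \<tau> (\<lambda>(x, y). x + y) \<and>
     continuous_map \<tau> \<tau> uminus"

definition seminorm_ball ::
    "('a::ab_group_add \<Rightarrow> ennreal) set \<Rightarrow> real \<Rightarrow> 'a \<Rightarrow> 'a set" where
  "seminorm_ball J \<epsilon> x = {y. \<forall>\<rho>\<in>J. \<rho> (y - x) < ennreal \<epsilon>}"

(* A family of extended seminorms is represented by its set of members: repeated members do not
   affect the induced neighbourhoods.  J may be empty, giving the whole space as a ball. *)
definition induced_by ::
    "('k::real_normed_field \<Rightarrow> 'a::ab_group_add \<Rightarrow> 'a) \<Rightarrow> 'a topology \<Rightarrow> ('a \<Rightarrow> ennreal) set \<Rightarrow> bool" where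
  "induced_by smul \<tau> P \<longleftrightarrow>
     topspace \<tau> = UNIV \<and>
     (\<forall>\<rho>\<in>P. extended_seminorm smul \<rho>) \<and>
     (\<forall>x. (\<forall>\<epsilon>>0. \<forall>J\<subseteq>P. finite J \<longrightarrow> nbhd \<tau> x (seminorm_ball J \<epsilon> x)) \<and>
          (\<forall>U. nbhd \<tau> x U \<longrightarrow> (\<exists>\<epsilon>>0. \<exists>J\<subseteq>P. finite J \<and> seminorm_ball J \<epsilon> x \<subseteq> U)))"

definition elcs ::
    "('k::real_normed_field \<Rightarrow> 'a::ab_group_add \<Rightarrow> 'a) \<Rightarrow> 'a topology \<Rightarrow> bool" where
  "elcs smul \<tau> \<longleftrightarrow>
     vector_space smul \<and> group_topology \<tau> \<and> (\<exists>P. induced_by smul \<tau> P)"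

definition continuous_dual ::
    "('k::real_normed_field \<Rightarrow> 'a::ab_group_add \<Rightarrow> 'a) \<Rightarrow> 'a topology \<Rightarrow> ('a \<Rightarrow> 'k) set" where
  "continuous_dual smul \<tau> =
     {f. Vector_Spaces.linear smul (*) f \<and> continuous_map \<tau> euclidean f}"

definition equicontinuous ::
    "'a::ab_group_add topology \<Rightarrow> ('a \<Rightarrow> 'k::real_normed_field) set \<Rightarrow> bool" where
  "equicontinuous \<tau> A \<longleftrightarrow> (\<exists>U. nbhd \<tau> 0 U \<and> (\<forall>f\<in>A. \<forall>x\<in>U. norm (f x) \<le> 1))"

(* The supremum is taken in [0, \<infinity>], so it is 0 when A is empty. *)
definition sup_seminorm :: "('a \<Rightarrow> 'k::real_normed_field) set \<Rightarrow> 'a \<Rightarrow> ennreal" where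
  "sup_seminorm A x = (SUP f\<in>A. ennreal (norm (f x)))"

end

theory Submission
  imports Defs
begin

text \<open>Fix a family \<open>P\<close> of extended seminorms inducing \<open>\<tau>\<close>. The seminorm balls of \<open>P\<close> can be
  rescaled, so a bound \<open>1\<close> for an equicontinuous set \<open>A\<close> near \<open>0\<close> becomes a bound \<open>\<epsilon>/2\<close> on a
  smaller ball around any point; hence the balls of the suprema \<open>\<rho>\<^sub>A\<close> are neighbourhoods
  (\<open>ball_of_equicontinuous_is_nbhd\<close>).

  For the converse, every continuous extended seminorm \<open>\<rho>\<close> is itself one of these suprema: take
  for \<open>A\<close> its polar, the set of all linear functionals \<open>f\<close> with \<open>|f| \<le> \<rho>\<close>
  (\<open>sup_seminorm_polar\<close>). That there are enough such \<open>f\<close> is the Hahn-Banach theorem for extended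
  seminorms (\<open>hahn_banach_real\<close>, \<open>hahn_banach_complex\<close>): for every finite \<open>c \<le> \<rho>(x)\<close> some \<open>f\<close>
  in the polar has \<open>|f(x)| \<ge> c\<close>. Infinite values only relax the constraints on \<open>f\<close>, so the
  classical extension argument goes through, and it applies also when \<open>\<rho>(x) = \<infinity>\<close>, where \<open>c\<close>
  may be taken arbitrarily large. Consequently each seminorm ball of \<open>P\<close> is
  literally a ball of the new family.\<close>

section \<open>Extended seminorms\<close>

lemma extended_seminorm_scale:
  "extended_seminorm smul \<rho> \<Longrightarrow> \<rho> (smul \<alpha> x) = ennreal (norm \<alpha>) * \<rho> x"
  by (simp add: extended_seminorm_def)

lemma extended_seminorm_add: "extended_seminorm smul \<rho> \<Longrightarrow> \<rho> (x + y) \<le> \<rho> x + \<rho> y"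
  by (simp add: extended_seminorm_def)

lemma extended_seminorm_minus:
  assumes "vector_space smul" "extended_seminorm smul \<rho>"
  shows "\<rho> (- x) = \<rho> x"
proof -
  interpret vector_space smul by fact
  show ?thesis
    using extended_seminorm_scale[OF assms(2), of "-1" x] by simp
qed

lemma linear_to_scalars_iff:
  fixes smul :: "'k::real_normed_field \<Rightarrow> 'a::ab_group_add \<Rightarrow> 'a"
  assumes "vector_space smul"
  shows "Vector_Spaces.linear smul (*) f \<longleftrightarrow>
    (\<forall>x y. f (x + y) = f x + f y) \<and> (\<forall>\<alpha> x. f (smul \<alpha> x) = \<alpha> * f x)"
proof -
  have "vector_space ((*) :: 'k \<Rightarrow> 'k \<Rightarrow> 'k)"
    by unfold_locales (auto simp: algebra_simps)
  then show ?thesis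
    using assms by (auto simp: Vector_Spaces.linear_iff)
qed

section \<open>The Hahn-Banach theorem for extended seminorms\<close>

text \<open>Partial linear functionals below \<open>\<rho>\<close> are handled through their graphs, since then extension
  is inclusion and the union of a chain is again such a graph. Single-valuedness is a
  consequence of domination by \<open>\<rho>\<close>, see \<open>dominated_graph_unique\<close>. For a value \<open>a < 0\<close> the
  condition \<open>ennreal a \<le> \<rho> x\<close> holds trivially, as it should.\<close>

definition dominated_graph ::
    "(real \<Rightarrow> 'a::ab_group_add \<Rightarrow> 'a) \<Rightarrow> ('a \<Rightarrow> ennreal) \<Rightarrow> ('a \<times> real) set \<Rightarrow> bool" where
  "dominated_graph smul \<rho> G \<longleftrightarrow>
     (0, 0) \<in> G \<and>
     (\<forall>x a y b. (x, a) \<in> G \<longrightarrow> (y, b) \<in> G \<longrightarrow> (x + y, a + b) \<in> G) \<and>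
     (\<forall>t x a. (x, a) \<in> G \<longrightarrow> (smul t x, t * a) \<in> G) \<and>
     (\<forall>x a. (x, a) \<in> G \<longrightarrow> ennreal a \<le> \<rho> x)"

lemma dominated_graphD:
  assumes "dominated_graph smul \<rho> G"
  shows "(0, 0) \<in> G"
    and "(x, a) \<in> G \<Longrightarrow> (y, b) \<in> G \<Longrightarrow> (x + y, a + b) \<in> G"
    and "(x, a) \<in> G \<Longrightarrow> (smul t x, t * a) \<in> G"
    and "(x, a) \<in> G \<Longrightarrow> ennreal a \<le> \<rho> x"
  using assms by (auto simp: dominated_graph_def)

text \<open>The difference of two values at one point is a value at \<open>0\<close>, and so is its negative; both are
  at most \<open>\<rho> 0 = 0\<close>.\<close>

lemma dominated_graph_unique:
  assumes vs: "vector_space smul" and es: "extended_seminorm smul \<rho>"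
    and G: "dominated_graph smul \<rho> G" and "(x, a) \<in> G" "(x, b) \<in> G"
  shows "a = b"
proof -
  interpret vector_space smul by fact
  have \<rho>0: "\<rho> 0 = 0"
    using extended_seminorm_scale[OF es, of 0 0] by simp
  have le: "a \<le> b" if "(x, a) \<in> G" "(x, b) \<in> G" for a b
  proof -
    have "(smul (-1) x, -1 * b) \<in> G"
      using dominated_graphD(3)[OF G that(2)] .
    from dominated_graphD(2)[OF G that(1) this] have "(0, a - b) \<in> G"
      by simp
    from dominated_graphD(4)[OF G this] show ?thesis
      by (simp add: \<rho>0 ennreal_eq_0_iff)
  qed
  show ?thesis
    using le assms(4,5) by (meson antisym)
qed

text \<open>A value \<open>a\<close> of the extended functional at \<open>v\<close> is admissible when it separates the numbers
  \<open>b - \<rho>(m - v)\<close> from the numbers \<open>\<rho>(m + v) - b\<close>, where only finite values of \<open>\<rho>\<close> matter. The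
  two sets are separated by the triangle inequality. If the first is empty, then so is the
  second, since \<open>\<rho>(-m + v) = \<rho>(m - v)\<close>, and any \<open>a\<close> will do.\<close>

lemma extension_value_exists:
  assumes vs: "vector_space smul" and es: "extended_seminorm smul \<rho>"
    and G: "dominated_graph smul \<rho> G"
  obtains a where "\<And>m b r. (m, b) \<in> G \<Longrightarrow> 0 \<le> r \<Longrightarrow> \<rho> (m - v) = ennreal r \<Longrightarrow> b - r \<le> a"
    and "\<And>m b r. (m, b) \<in> G \<Longrightarrow> 0 \<le> r \<Longrightarrow> \<rho> (m + v) = ennreal r \<Longrightarrow> a \<le> r - b"
proof -
  interpret vector_space smul by fact
  define L where "L = {b - r | m b r. (m, b) \<in> G \<and> 0 \<le> r \<and> \<rho> (m - v) = ennreal r}"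
  have sep: "l \<le> r - b"
    if l: "l \<in> L" and r: "(m, b) \<in> G" "0 \<le> r" "\<rho> (m + v) = ennreal r" for l m b r
  proof -
    obtain m' b' r' where l': "l = b' - r'" "(m', b') \<in> G" "0 \<le> r'" "\<rho> (m' - v) = ennreal r'"
      using l unfolding L_def by blast
    have "ennreal (b' + b) \<le> \<rho> (m' + m)"
      by (rule dominated_graphD(4)[OF G dominated_graphD(2)[OF G l'(2) r(1)]])
    also have "m' + m = (m' - v) + (m + v)"
      by simp
    also have "\<rho> \<dots> \<le> \<rho> (m' - v) + \<rho> (m + v)"
      by (rule extended_seminorm_add[OF es])
    also have "\<dots> = ennreal (r' + r)"
      using l' r by (simp add: ennreal_plus)
    finally have "b' + b \<le> r' + r"
      using l'(3) r(2) by (subst (asm) ennreal_le_iff) auto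
    then show ?thesis
      using l'(1) by simp
  qed
  have flip: "\<exists>l. l \<in> L" if "(m, b) \<in> G" "0 \<le> r" "\<rho> (m + v) = ennreal r" for m b r
  proof -
    have "(- m, - b) \<in> G"
      using dominated_graphD(3)[OF G that(1), of "-1"] by simp
    moreover have "\<rho> (- m - v) = ennreal r"
      using extended_seminorm_minus[OF vs es, of "m + v"] that(3) by simp
    ultimately show ?thesis
      using that(2) unfolding L_def by blast
  qed
  have flip': "\<exists>m b r. (m, b) \<in> G \<and> 0 \<le> r \<and> \<rho> (m + v) = ennreal r" if "l \<in> L" for l
  proof -
    obtain m b r where mbr: "(m, b) \<in> G" "0 \<le> r" "\<rho> (m - v) = ennreal r"
      using \<open>l \<in> L\<close> unfolding L_def by blast
    have "(- m, - b) \<in> G"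
      using dominated_graphD(3)[OF G mbr(1), of "-1"] by simp
    moreover have "\<rho> (- m + v) = ennreal r"
      using extended_seminorm_minus[OF vs es, of "m - v"] mbr(3) by simp
    ultimately show ?thesis
      using mbr(2) by blast
  qed
  show thesis
  proof (rule that[of "Sup L"])
    fix m b r assume *: "(m, b) \<in> G" "0 \<le> r" "\<rho> (m - v) = ennreal r"
    then have inL: "b - r \<in> L"
      unfolding L_def by blast
    have "bdd_above L"
      using flip'[OF inL] sep by (meson bdd_aboveI)
    then show "b - r \<le> Sup L"
      by (rule cSup_upper[OF inL])
  next
    fix m b r assume *: "(m, b) \<in> G" "0 \<le> r" "\<rho> (m + v) = ennreal r"
    show "Sup L \<le> r - b"
      using flip[OF *] sep[OF _ *] by (intro cSup_least) auto
  qed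
qed

text \<open>Scaling reduces domination at \<open>m + t v\<close> to the cases \<open>t = 1\<close> and \<open>t = -1\<close>, which are the
  two conditions on the value \<open>a\<close>.\<close>

lemma dominated_graph_extend:
  assumes vs: "vector_space smul" and es: "extended_seminorm smul \<rho>"
    and G: "dominated_graph smul \<rho> G"
  obtains G' a where "dominated_graph smul \<rho> G'" "G \<subseteq> G'" "(v, a) \<in> G'"
proof -
  interpret vector_space smul by fact
  obtain a where
    lower: "\<And>m b r. (m, b) \<in> G \<Longrightarrow> 0 \<le> r \<Longrightarrow> \<rho> (m - v) = ennreal r \<Longrightarrow> b - r \<le> a"
    and upper: "\<And>m b r. (m, b) \<in> G \<Longrightarrow> 0 \<le> r \<Longrightarrow> \<rho> (m + v) = ennreal r \<Longrightarrow> a \<le> r - b"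
    by (rule extension_value_exists[OF vs es G, of v]) (rule that)
  have scaled: "ennreal (s * c) \<le> \<rho> (smul s w)"
    if "0 < s" and c: "\<And>r. 0 \<le> r \<Longrightarrow> \<rho> w = ennreal r \<Longrightarrow> c \<le> r" for s c w
  proof -
    have "ennreal c \<le> \<rho> w"
      using c by (cases "\<rho> w") (auto intro: ennreal_leI)
    then have "ennreal s * ennreal c \<le> ennreal s * \<rho> w"
      by (rule mult_left_mono) simp
    then show ?thesis
      using \<open>0 < s\<close> by (simp add: extended_seminorm_scale[OF es] ennreal_mult')
  qed
  have dom: "ennreal (b + t * a) \<le> \<rho> (m + smul t v)" if mb: "(m, b) \<in> G" for m b t
  proof -
    consider "t = 0" | "t > 0" | "t < 0"
      by linarith
    then show ?thesis
    proof cases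
      case 1
      then show ?thesis
        using dominated_graphD(4)[OF G mb] by simp
    next
      case 2
      let ?w = "smul (1 / t) m + v"
      have "(smul (1 / t) m, (1 / t) * b) \<in> G"
        by (rule dominated_graphD(3)[OF G mb])
      from upper[OF this] have "b / t + a \<le> r" if "0 \<le> r" "\<rho> ?w = ennreal r" for r
        using that by force
      from scaled[OF 2 this] have "ennreal (t * (b / t + a)) \<le> \<rho> (smul t ?w)"
        by blast
      moreover have "t * (b / t + a) = b + t * a"
        using 2 by (simp add: field_simps)
      moreover have "smul t ?w = m + smul t v"
        using 2 by (simp add: scale_right_distrib)
      ultimately show ?thesis
        by simp
    next
      case 3
      define s where "s = - t"
      have s: "0 < s" "t = - s"
        using 3 by (auto simp: s_def)
      let ?w = "smul (1 / s) m - v"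
      have "(smul (1 / s) m, (1 / s) * b) \<in> G"
        by (rule dominated_graphD(3)[OF G mb])
      from lower[OF this] have "b / s - a \<le> r" if "0 \<le> r" "\<rho> ?w = ennreal r" for r
        using that by force
      from scaled[OF s(1) this] have "ennreal (s * (b / s - a)) \<le> \<rho> (smul s ?w)"
        by blast
      moreover have "s * (b / s - a) = b + t * a"
        using s by (simp add: field_simps)
      moreover have "smul s ?w = m + smul t v"
        using s by (simp add: scale_right_diff_distrib)
      ultimately show ?thesis
        by simp
    qed
  qed
  define G' where "G' = {(m + smul t v, b + t * a) | m b t. (m, b) \<in> G}"
  have G'I: "(x, c) \<in> G'" if "(m, b) \<in> G" "x = m + smul t v" "c = b + t * a" for x c m b t
    using that unfolding G'_def by blast
  have "dominated_graph smul \<rho> G'"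
    unfolding dominated_graph_def
  proof (intro conjI allI impI)
    show "(0, 0) \<in> G'"
      by (rule G'I[OF dominated_graphD(1)[OF G], of _ 0]) auto
  next
    fix x c y d assume "(x, c) \<in> G'" "(y, d) \<in> G'"
    then obtain m b t n e u where
      *: "(m, b) \<in> G" "x = m + smul t v" "c = b + t * a"
         "(n, e) \<in> G" "y = n + smul u v" "d = e + u * a"
      unfolding G'_def by blast
    show "(x + y, c + d) \<in> G'"
      by (rule G'I[OF dominated_graphD(2)[OF G *(1,4)], of _ "t + u"])
        (auto simp: * algebra_simps scale_left_distrib)
  next
    fix s x c assume "(x, c) \<in> G'"
    then obtain m b t where *: "(m, b) \<in> G" "x = m + smul t v" "c = b + t * a"
      unfolding G'_def by blast
    show "(smul s x, s * c) \<in> G'"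
      by (rule G'I[OF dominated_graphD(3)[OF G *(1), of s], of _ "s * t"])
        (auto simp: * algebra_simps scale_right_distrib)
  next
    fix x c assume "(x, c) \<in> G'"
    then show "ennreal c \<le> \<rho> x"
      using dom unfolding G'_def by blast
  qed
  moreover have "G \<subseteq> G'"
    by (auto intro: G'I[of _ _ _ 0])
  moreover have "(v, a) \<in> G'"
    by (rule G'I[OF dominated_graphD(1)[OF G], of _ 1]) auto
  ultimately show thesis
    by (rule that)
qed

theorem hahn_banach_real:
  fixes smul :: "real \<Rightarrow> 'a::ab_group_add \<Rightarrow> 'a"
  assumes vs: "vector_space smul" and es: "extended_seminorm smul \<rho>"
    and c: "0 \<le> c" "ennreal c \<le> \<rho> x\<^sub>0"
  obtains f where "Vector_Spaces.linear smul (*) f" "\<And>x. ennreal \<bar>f x\<bar> \<le> \<rho> x" "f x\<^sub>0 = c"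
proof -
  interpret vector_space smul by fact
  define G\<^sub>0 where "G\<^sub>0 = {(smul t x\<^sub>0, t * c) | t. True}"
  have G\<^sub>0I: "(x, b) \<in> G\<^sub>0" if "x = smul t x\<^sub>0" "b = t * c" for x b t
    using that unfolding G\<^sub>0_def by blast
  have G\<^sub>0: "dominated_graph smul \<rho> G\<^sub>0"
    unfolding dominated_graph_def
  proof (intro conjI allI impI)
    show "(0, 0) \<in> G\<^sub>0"
      by (rule G\<^sub>0I[of _ 0]) auto
  next
    fix x a y b assume "(x, a) \<in> G\<^sub>0" "(y, b) \<in> G\<^sub>0"
    then obtain t u where *: "x = smul t x\<^sub>0" "a = t * c" "y = smul u x\<^sub>0" "b = u * c"
      unfolding G\<^sub>0_def by blast
    show "(x + y, a + b) \<in> G\<^sub>0"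
      by (rule G\<^sub>0I[of _ "t + u"]) (auto simp: * algebra_simps scale_left_distrib)
  next
    fix s x a assume "(x, a) \<in> G\<^sub>0"
    then obtain t where *: "x = smul t x\<^sub>0" "a = t * c"
      unfolding G\<^sub>0_def by blast
    show "(smul s x, s * a) \<in> G\<^sub>0"
      by (rule G\<^sub>0I[of _ "s * t"]) (auto simp: *)
  next
    fix x a assume "(x, a) \<in> G\<^sub>0"
    then obtain t where *: "x = smul t x\<^sub>0" "a = t * c"
      unfolding G\<^sub>0_def by blast
    have "ennreal a \<le> ennreal (\<bar>t\<bar> * c)"
      unfolding * using c(1) by (intro ennreal_leI mult_right_mono) auto
    also have "\<dots> = ennreal \<bar>t\<bar> * ennreal c"
      by (simp add: ennreal_mult')
    also have "\<dots> \<le> ennreal \<bar>t\<bar> * \<rho> x\<^sub>0"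
      using c(2) by (rule mult_left_mono) simp
    finally show "ennreal a \<le> \<rho> x"
      by (simp add: * extended_seminorm_scale[OF es])
  qed
  define \<A> where "\<A> = {G. dominated_graph smul \<rho> G \<and> G\<^sub>0 \<subseteq> G}"
  have "\<exists>M\<in>\<A>. \<forall>G\<in>\<A>. M \<subseteq> G \<longrightarrow> G = M"
  proof (rule subset_Zorn_nonempty)
    show "\<A> \<noteq> {}"
      using G\<^sub>0 unfolding \<A>_def by blast
  next
    fix C assume "C \<noteq> {}" and chain: "subset.chain \<A> C"
    then obtain H where H: "H \<in> C"
      by blast
    have graph: "dominated_graph smul \<rho> G" "G\<^sub>0 \<subseteq> G" if "G \<in> C" for G
      using chain that unfolding subset.chain_def \<A>_def by auto
    have "dominated_graph smul \<rho> (\<Union>C)"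
      unfolding dominated_graph_def
    proof (intro conjI allI impI)
      show "(0, 0) \<in> \<Union>C"
        using H dominated_graphD(1)[OF graph(1)] by blast
    next
      fix x a y b assume "(x, a) \<in> \<Union>C" "(y, b) \<in> \<Union>C"
      then obtain G where "G \<in> C" "(x, a) \<in> G" "(y, b) \<in> G"
        using chain unfolding subset.chain_def by blast
      then show "(x + y, a + b) \<in> \<Union>C"
        using dominated_graphD(2)[OF graph(1)] by blast
    next
      fix t x a assume "(x, a) \<in> \<Union>C"
      then show "(smul t x, t * a) \<in> \<Union>C"
        using dominated_graphD(3)[OF graph(1)] by blast
    next
      fix x a assume "(x, a) \<in> \<Union>C"
      then show "ennreal a \<le> \<rho> x"
        using dominated_graphD(4)[OF graph(1)] by blast
    qed
    moreover have "G\<^sub>0 \<subseteq> \<Union>C"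
      using H graph(2) by blast
    ultimately show "\<Union>C \<in> \<A>"
      unfolding \<A>_def by blast
  qed
  then obtain M where "M \<in> \<A>" and max: "\<And>G. G \<in> \<A> \<Longrightarrow> M \<subseteq> G \<Longrightarrow> G = M"
    by blast
  then have M: "dominated_graph smul \<rho> M" and "G\<^sub>0 \<subseteq> M"
    unfolding \<A>_def by auto
  have total: "\<exists>a. (x, a) \<in> M" for x
  proof -
    obtain G' a where G': "dominated_graph smul \<rho> G'" "M \<subseteq> G'" "(x, a) \<in> G'"
      by (rule dominated_graph_extend[OF vs es M])
    with \<open>G\<^sub>0 \<subseteq> M\<close> have "G' = M"
      by (intro max) (auto simp: \<A>_def)
    with G'(3) show ?thesis
      by blast
  qed
  define f where "f x = (SOME a. (x, a) \<in> M)" for x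
  have fM: "(x, f x) \<in> M" for x
    unfolding f_def using total by (rule someI_ex)
  have f_eq: "f x = a" if "(x, a) \<in> M" for x a
    by (rule dominated_graph_unique[OF vs es M fM that])
  have lin: "Vector_Spaces.linear smul (*) f"
    unfolding linear_to_scalars_iff[OF vs]
    using f_eq dominated_graphD(2,3)[OF M] fM by blast
  have "ennreal \<bar>f x\<bar> \<le> \<rho> x" for x
  proof -
    have "(- x, - f x) \<in> M"
      using dominated_graphD(3)[OF M fM, of "-1" x] by simp
    from dominated_graphD(4)[OF M this] have "ennreal (- f x) \<le> \<rho> x"
      by (simp add: extended_seminorm_minus[OF vs es])
    with dominated_graphD(4)[OF M fM[of x]] show ?thesis
      by (simp add: abs_if)
  qed
  moreover have "f x\<^sub>0 = c"
    using \<open>G\<^sub>0 \<subseteq> M\<close> G\<^sub>0I[of x\<^sub>0 1 c] by (intro f_eq) auto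
  ultimately show thesis
    using that lin by blast
qed

text \<open>The real functional \<open>g\<close> is the real part of the complex functional \<open>x \<mapsto> g(x) - \<i> g(\<i> x)\<close>.
  Rotating \<open>x\<close> so that the value becomes real transfers the bound on \<open>g\<close>.\<close>

theorem hahn_banach_complex:
  fixes smul :: "complex \<Rightarrow> 'a::ab_group_add \<Rightarrow> 'a"
  assumes vs: "vector_space smul" and es: "extended_seminorm smul \<rho>"
    and c: "0 \<le> c" "ennreal c \<le> \<rho> x\<^sub>0"
  obtains f where "Vector_Spaces.linear smul (*) f" "\<And>x. ennreal (norm (f x)) \<le> \<rho> x"
    "c \<le> norm (f x\<^sub>0)"
proof -
  interpret vector_space smul by fact
  define rmul where "rmul t x = smul (of_real t) x" for t x
  have vsr: "vector_space rmul"
    by unfold_locales (auto simp: rmul_def scale_right_distrib scale_left_distrib)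
  have esr: "extended_seminorm rmul \<rho>"
    using es by (simp add: extended_seminorm_def rmul_def)
  obtain g where "Vector_Spaces.linear rmul (*) g"
    and g_le: "\<And>x. ennreal \<bar>g x\<bar> \<le> \<rho> x" and g_eq: "g x\<^sub>0 = c"
    by (rule hahn_banach_real[OF vsr esr c]) (rule that)
  from \<open>Vector_Spaces.linear rmul (*) g\<close>
  have g_add: "g (x + y) = g x + g y" and g_scale: "g (smul (of_real t) x) = t * g x"
    for x y t
    unfolding linear_to_scalars_iff[OF vsr] rmul_def by auto
  define f where "f x = Complex (g x) (- g (smul \<i> x))" for x
  have g_i: "g (smul (\<i> * of_real t) x) = t * g (smul \<i> x)" for t x
    using g_scale[of t "smul \<i> x"] by (simp add: mult.commute)
  have f_add: "f (x + y) = f x + f y" for x y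
    by (simp add: f_def complex_eq_iff g_add scale_right_distrib)
  have g_smul: "g (smul \<alpha> x) = Re \<alpha> * g x + Im \<alpha> * g (smul \<i> x)" for \<alpha> x
  proof -
    have "smul \<alpha> x = smul (of_real (Re \<alpha>)) x + smul (\<i> * of_real (Im \<alpha>)) x"
      unfolding scale_left_distrib[symmetric] by (simp add: complex_eq[symmetric])
    then show ?thesis
      by (simp only: g_add g_scale g_i)
  qed
  have f_scale: "f (smul \<alpha> x) = \<alpha> * f x" for \<alpha> x
    using g_smul[of \<alpha> x] g_smul[of "\<i> * \<alpha>" x]
    by (simp add: f_def complex_eq_iff algebra_simps)
  have f_le: "ennreal (norm (f x)) \<le> \<rho> x" for x
  proof (cases "f x = 0")
    case False
    \<comment> \<open>the unit scalar that turns \<open>f x\<close> into its modulus\<close>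
    define u where "u = cnj (f x) / of_real (norm (f x))"
    have "norm u = 1"
      using False by (simp add: u_def norm_divide)
    have "f (smul u x) = of_real (norm (f x))"
      using False
      by (simp add: f_scale u_def divide_simps mult.commute complex_norm_square[symmetric]
          power2_eq_square)
    then have "norm (f x) = g (smul u x)"
      by (simp add: f_def complex_eq_iff)
    then have "ennreal (norm (f x)) \<le> ennreal \<bar>g (smul u x)\<bar>"
      by (intro ennreal_leI) simp
    also have "\<dots> \<le> \<rho> (smul u x)"
      by (rule g_le)
    also have "\<dots> = \<rho> x"
      using \<open>norm u = 1\<close> by (simp add: extended_seminorm_scale[OF es])
    finally show ?thesis .
  qed simp
  have "Vector_Spaces.linear smul (*) f"
    unfolding linear_to_scalars_iff[OF vs] using f_add f_scale by blast
  moreover have "c \<le> norm (f x\<^sub>0)"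
    using complex_Re_le_cmod[of "f x\<^sub>0"] by (simp add: f_def g_eq)
  ultimately show thesis
    using that f_le by blast
qed

section \<open>Extended seminorms as suprema of functionals\<close>

lemma extended_seminorm_sup_seminorm:
  assumes vs: "vector_space smul" and A: "\<And>f. f \<in> A \<Longrightarrow> Vector_Spaces.linear smul (*) f"
  shows "extended_seminorm smul (sup_seminorm A)"
  unfolding extended_seminorm_def
proof (intro conjI allI)
  fix \<alpha> x
  have "sup_seminorm A (smul \<alpha> x) = (SUP f\<in>A. ennreal (norm \<alpha>) * ennreal (norm (f x)))"
    unfolding sup_seminorm_def
  proof (intro SUP_cong refl)
    fix f assume "f \<in> A"
    then have "f (smul \<alpha> x) = \<alpha> * f x"
      using A[of f] by (simp add: linear_to_scalars_iff[OF vs])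
    then show "ennreal (norm (f (smul \<alpha> x))) = ennreal (norm \<alpha>) * ennreal (norm (f x))"
      by (simp add: norm_mult ennreal_mult')
  qed
  then show "sup_seminorm A (smul \<alpha> x) = ennreal (norm \<alpha>) * sup_seminorm A x"
    by (simp add: sup_seminorm_def SUP_mult_left_ennreal)
next
  fix x y
  show "sup_seminorm A (x + y) \<le> sup_seminorm A x + sup_seminorm A y"
    unfolding sup_seminorm_def
  proof (rule SUP_least)
    fix f assume f: "f \<in> A"
    have "ennreal (norm (f (x + y))) \<le> ennreal (norm (f x) + norm (f y))"
      using A[OF f] by (intro ennreal_leI) (simp add: linear_to_scalars_iff[OF vs] norm_triangle_ineq)
    also have "\<dots> = ennreal (norm (f x)) + ennreal (norm (f y))"
      by (simp add: ennreal_plus)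
    also have "\<dots> \<le> (SUP f\<in>A. ennreal (norm (f x))) + (SUP f\<in>A. ennreal (norm (f y)))"
      using f by (intro add_mono SUP_upper)
    finally show "ennreal (norm (f (x + y)))
        \<le> (SUP f\<in>A. ennreal (norm (f x))) + (SUP f\<in>A. ennreal (norm (f y)))" .
  qed
qed

definition polar ::
    "('k::real_normed_field \<Rightarrow> 'a::ab_group_add \<Rightarrow> 'a) \<Rightarrow> ('a \<Rightarrow> ennreal) \<Rightarrow> ('a \<Rightarrow> 'k) set" where
  "polar smul \<rho> = {f. Vector_Spaces.linear smul (*) f \<and> (\<forall>x. ennreal (norm (f x)) \<le> \<rho> x)}"

text \<open>The conclusion of the Hahn-Banach theorem, the only point at which the real and the complex
  case differ.\<close>

definition hahn_banach_property :: "('k::real_normed_field \<Rightarrow> 'a::ab_group_add \<Rightarrow> 'a) \<Rightarrow> bool" where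
  "hahn_banach_property smul \<longleftrightarrow>
     (\<forall>\<rho> c x. extended_seminorm smul \<rho> \<longrightarrow> 0 \<le> c \<longrightarrow> ennreal c \<le> \<rho> x \<longrightarrow>
        (\<exists>f\<in>polar smul \<rho>. c \<le> norm (f x)))"

lemma hahn_banach_property_real:
  fixes smul :: "real \<Rightarrow> 'a::ab_group_add \<Rightarrow> 'a"
  assumes "vector_space smul"
  shows "hahn_banach_property smul"
  unfolding hahn_banach_property_def
proof (intro allI impI)
  fix \<rho> c x
  assume "extended_seminorm smul \<rho>" "0 \<le> c" "ennreal c \<le> \<rho> x"
  then obtain f where "Vector_Spaces.linear smul (*) f" "\<And>y. ennreal \<bar>f y\<bar> \<le> \<rho> y" "f x = c"
    using hahn_banach_real[OF assms] by metis
  then show "\<exists>f\<in>polar smul \<rho>. c \<le> norm (f x)"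
    by (intro bexI[of _ f]) (auto simp: polar_def)
qed

lemma hahn_banach_property_complex:
  fixes smul :: "complex \<Rightarrow> 'a::ab_group_add \<Rightarrow> 'a"
  assumes "vector_space smul"
  shows "hahn_banach_property smul"
  unfolding hahn_banach_property_def
proof (intro allI impI)
  fix \<rho> c x
  assume "extended_seminorm smul \<rho>" "0 \<le> c" "ennreal c \<le> \<rho> x"
  then obtain f where "Vector_Spaces.linear smul (*) f" "\<And>y. ennreal (norm (f y)) \<le> \<rho> y"
    "c \<le> norm (f x)"
    using hahn_banach_complex[OF assms] by metis
  then show "\<exists>f\<in>polar smul \<rho>. c \<le> norm (f x)"
    by (intro bexI[of _ f]) (auto simp: polar_def)
qed

text \<open>Testing only finite \<open>c \<le> \<rho> x\<close> suffices, because also an infinite value is the supremum of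
  the finite numbers below it.\<close>

lemma sup_seminorm_polar:
  assumes "hahn_banach_property smul" "extended_seminorm smul \<rho>"
  shows "sup_seminorm (polar smul \<rho>) = \<rho>"
proof (intro ext antisym)
  fix x
  show "sup_seminorm (polar smul \<rho>) x \<le> \<rho> x"
    unfolding sup_seminorm_def polar_def by (intro SUP_least) auto
  show "\<rho> x \<le> sup_seminorm (polar smul \<rho>) x"
  proof (rule dense_le)
    fix z assume z: "z < \<rho> x"
    then obtain c where c: "z = ennreal c" "0 \<le> c"
      by (cases z) auto
    with z assms obtain f where f: "f \<in> polar smul \<rho>" "c \<le> norm (f x)"
      unfolding hahn_banach_property_def by (meson less_imp_le)
    have "z \<le> ennreal (norm (f x))"
      unfolding c(1) by (rule ennreal_leI[OF f(2)])
    also have "\<dots> \<le> sup_seminorm (polar smul \<rho>) x"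
      unfolding sup_seminorm_def by (rule SUP_upper[OF f(1)])
    finally show "z \<le> sup_seminorm (polar smul \<rho>) x" .
  qed
qed

section \<open>Equicontinuous sets and the induced topology\<close>

lemma nbhd_mono: "nbhd \<tau> x U \<Longrightarrow> U \<subseteq> W \<Longrightarrow> W \<subseteq> topspace \<tau> \<Longrightarrow> nbhd \<tau> x W"
  unfolding nbhd_def by (meson order.trans)

lemma nbhd_Int: "nbhd \<tau> x U \<Longrightarrow> nbhd \<tau> x W \<Longrightarrow> nbhd \<tau> x (U \<inter> W)"
  unfolding nbhd_def by (meson IntI Int_mono le_infI1 openin_Int)

lemma seminorm_ball_empty: "seminorm_ball {} \<epsilon> x = UNIV"
  by (simp add: seminorm_ball_def)

lemma seminorm_ball_insert:
  "seminorm_ball (insert \<rho> J) \<epsilon> x = seminorm_ball {\<rho>} \<epsilon> x \<inter> seminorm_ball J \<epsilon> x"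
  by (auto simp: seminorm_ball_def)

lemma induced_byD:
  assumes "induced_by smul \<tau> P"
  shows "topspace \<tau> = UNIV"
    and "\<rho> \<in> P \<Longrightarrow> extended_seminorm smul \<rho>"
    and "0 < \<epsilon> \<Longrightarrow> J \<subseteq> P \<Longrightarrow> finite J \<Longrightarrow> nbhd \<tau> x (seminorm_ball J \<epsilon> x)"
    and "nbhd \<tau> x U \<Longrightarrow> \<exists>\<epsilon>>0. \<exists>J\<subseteq>P. finite J \<and> seminorm_ball J \<epsilon> x \<subseteq> U"
  using assms unfolding induced_by_def by blast+

text \<open>On the \<open>\<rho>\<close>-ball of radius \<open>e\<close> around \<open>x\<close>, linearity and \<open>|f| \<le> \<rho>\<close> keep \<open>f\<close> within
  distance \<open>e\<close> of \<open>f x\<close>, and this ball is a neighbourhood of \<open>x\<close>.\<close>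

lemma polar_subset_continuous_dual:
  assumes vs: "vector_space smul" and P: "induced_by smul \<tau> P" and \<rho>: "\<rho> \<in> P"
  shows "polar smul \<rho> \<subseteq> continuous_dual smul \<tau>"
proof
  fix f assume "f \<in> polar smul \<rho>"
  then have lin: "Vector_Spaces.linear smul (*) f" and le: "\<And>x. ennreal (norm (f x)) \<le> \<rho> x"
    unfolding polar_def by auto
  have diff: "f (y - x) = f y - f x" for x y
    using lin unfolding linear_to_scalars_iff[OF vs] by (metis add_diff_cancel diff_add_cancel)
  have "openin \<tau> {x. f x \<in> S}" if "open S" for S
  proof (subst openin_subopen, intro ballI)
    fix x assume "x \<in> {x. f x \<in> S}"
    then obtain e where "0 < e" and e: "ball (f x) e \<subseteq> S"
      using \<open>open S\<close> by (auto simp: open_contains_ball)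
    obtain V where V: "openin \<tau> V" "x \<in> V" "V \<subseteq> seminorm_ball {\<rho>} e x"
      using induced_byD(3)[OF P \<open>0 < e\<close>, of "{\<rho>}" x] \<rho> by (auto simp: nbhd_def)
    have "f y \<in> S" if "y \<in> V" for y
    proof -
      have "\<rho> (y - x) < ennreal e"
        using V(3) that by (auto simp: seminorm_ball_def)
      then have "ennreal (norm (f y - f x)) < ennreal e"
        using le[of "y - x"] by (simp add: diff)
      then have "dist (f x) (f y) < e"
        by (simp add: dist_norm norm_minus_commute ennreal_less_iff)
      then show ?thesis
        using e by auto
    qed
    with V show "\<exists>T. openin \<tau> T \<and> x \<in> T \<and> T \<subseteq> {x. f x \<in> S}"
      by blast
  qed
  then have "continuous_map \<tau> euclidean f"
    by (simp add: continuous_map_def induced_byD(1)[OF P])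
  with lin show "f \<in> continuous_dual smul \<tau>"
    by (simp add: continuous_dual_def)
qed

lemma equicontinuous_polar:
  assumes P: "induced_by smul \<tau> P" and \<rho>: "\<rho> \<in> P"
  shows "equicontinuous \<tau> (polar smul \<rho>)"
  unfolding equicontinuous_def
proof (intro exI conjI ballI)
  show "nbhd \<tau> 0 (seminorm_ball {\<rho>} 1 0)"
    using induced_byD(3)[OF P, of 1 "{\<rho>}" 0] \<rho> by simp
next
  fix f x assume "f \<in> polar smul \<rho>" "x \<in> seminorm_ball {\<rho>} 1 0"
  then have "ennreal (norm (f x)) \<le> \<rho> x" "\<rho> x \<le> 1"
    by (auto simp: polar_def seminorm_ball_def)
  then have "ennreal (norm (f x)) \<le> 1"
    by (rule order.trans)
  then show "norm (f x) \<le> 1"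
    by simp
qed

text \<open>If all functionals in \<open>A\<close> are bounded by \<open>1\<close> on the ball of radius \<open>\<delta>\<close> around \<open>0\<close>, then they
  are bounded by \<open>\<epsilon>/2\<close> on that of radius \<open>\<delta> \<epsilon>/2\<close>; halving makes the bound on the supremum
  strict.\<close>

lemma ball_of_equicontinuous_is_nbhd:
  assumes vs: "vector_space smul" and P: "induced_by smul \<tau> P"
    and A: "A \<subseteq> continuous_dual smul \<tau>" "equicontinuous \<tau> A" and "0 < \<epsilon>"
  shows "nbhd \<tau> x (seminorm_ball {sup_seminorm A} \<epsilon> x)"
proof -
  obtain U where "nbhd \<tau> 0 U" and U: "\<And>f y. f \<in> A \<Longrightarrow> y \<in> U \<Longrightarrow> norm (f y) \<le> 1"
    using A(2) unfolding equicontinuous_def by blast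
  obtain \<delta> J where "0 < \<delta>" and J: "J \<subseteq> P" "finite J" and sub: "seminorm_ball J \<delta> 0 \<subseteq> U"
    using induced_byD(4)[OF P \<open>nbhd \<tau> 0 U\<close>] by blast
  have "seminorm_ball J (\<delta> * (\<epsilon> / 2)) x \<subseteq> seminorm_ball {sup_seminorm A} \<epsilon> x"
  proof
    fix y assume y: "y \<in> seminorm_ball J (\<delta> * (\<epsilon> / 2)) x"
    let ?z = "smul (of_real (2 / \<epsilon>)) (y - x)"
    have "\<rho> ?z < ennreal \<delta>" if "\<rho> \<in> J" for \<rho>
    proof -
      have es: "extended_seminorm smul \<rho>"
        using induced_byD(2)[OF P] J(1) that by blast
      have "\<rho> ?z = ennreal (2 / \<epsilon>) * \<rho> (y - x)"
        using \<open>0 < \<epsilon>\<close> by (simp only: extended_seminorm_scale[OF es] norm_of_real) simp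
      also have "\<dots> < ennreal (2 / \<epsilon>) * ennreal (\<delta> * (\<epsilon> / 2))"
        using y that \<open>0 < \<epsilon>\<close>
        by (intro ennreal_mult_strict_left_mono) (auto simp: seminorm_ball_def)
      also have "\<dots> = ennreal ((2 / \<epsilon>) * (\<delta> * (\<epsilon> / 2)))"
        using \<open>0 < \<epsilon>\<close> \<open>0 < \<delta>\<close> by (intro ennreal_mult[symmetric]) auto
      also have "(2 / \<epsilon>) * (\<delta> * (\<epsilon> / 2)) = \<delta>"
        using \<open>0 < \<epsilon>\<close> by simp
      finally show ?thesis .
    qed
    then have z: "?z \<in> U"
      using sub by (auto simp: seminorm_ball_def)
    have "norm (f (y - x)) \<le> \<epsilon> / 2" if "f \<in> A" for f
    proof -
      have "Vector_Spaces.linear smul (*) f"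
        using A(1) that unfolding continuous_dual_def by blast
      then have "norm (f ?z) = (2 / \<epsilon>) * norm (f (y - x))"
        using \<open>0 < \<epsilon>\<close> by (simp only: linear_to_scalars_iff[OF vs] norm_mult norm_of_real) simp
      then have "(2 / \<epsilon>) * norm (f (y - x)) \<le> 1"
        using U[OF that z] by (simp only:)
      from mult_left_mono[OF this, of "\<epsilon> / 2"] \<open>0 < \<epsilon>\<close> show ?thesis
        by simp
    qed
    then have "sup_seminorm A (y - x) \<le> ennreal (\<epsilon> / 2)"
      unfolding sup_seminorm_def by (intro SUP_least ennreal_leI)
    also have "\<dots> < ennreal \<epsilon>"
      using \<open>0 < \<epsilon>\<close> by (simp add: ennreal_less_iff)
    finally show "y \<in> seminorm_ball {sup_seminorm A} \<epsilon> x"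
      by (simp add: seminorm_ball_def)
  qed
  from _ this show ?thesis
  proof (rule nbhd_mono)
    show "nbhd \<tau> x (seminorm_ball J (\<delta> * (\<epsilon> / 2)) x)"
      using \<open>0 < \<epsilon>\<close> \<open>0 < \<delta>\<close> J by (intro induced_byD(3)[OF P]) auto
    show "seminorm_ball {sup_seminorm A} \<epsilon> x \<subseteq> topspace \<tau>"
      by (simp add: induced_byD(1)[OF P])
  qed
qed

theorem induced_by_equicontinuous_sets:
  assumes hb: "hahn_banach_property smul" and "elcs smul \<tau>"
  shows "induced_by smul \<tau>
    {sup_seminorm A | A. A \<subseteq> continuous_dual smul \<tau> \<and> equicontinuous \<tau> A}"
    (is "induced_by smul \<tau> ?Q")
proof -
  have vs: "vector_space smul"
    using \<open>elcs smul \<tau>\<close> by (simp add: elcs_def)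
  obtain P where P: "induced_by smul \<tau> P"
    using \<open>elcs smul \<tau>\<close> by (auto simp: elcs_def)
  have "P \<subseteq> ?Q"
  proof
    fix \<rho> assume \<rho>: "\<rho> \<in> P"
    have "\<rho> = sup_seminorm (polar smul \<rho>)"
      using sup_seminorm_polar[OF hb induced_byD(2)[OF P \<rho>]] by simp
    then show "\<rho> \<in> ?Q"
      using polar_subset_continuous_dual[OF vs P \<rho>] equicontinuous_polar[OF P \<rho>] by blast
  qed
  have ball: "nbhd \<tau> x (seminorm_ball J \<epsilon> x)" if "0 < \<epsilon>" "finite J" "J \<subseteq> ?Q" for x \<epsilon> J
    using that(2,3)
  proof (induction J rule: finite_induct)
    case empty
    show ?case
      using induced_byD(3)[OF P, of 1 "{}" x] by (simp add: seminorm_ball_empty)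
  next
    case (insert \<rho> J)
    then obtain A where "\<rho> = sup_seminorm A" "A \<subseteq> continuous_dual smul \<tau>" "equicontinuous \<tau> A"
      by blast
    then have "nbhd \<tau> x (seminorm_ball {\<rho>} \<epsilon> x)"
      using ball_of_equicontinuous_is_nbhd[OF vs P _ _ \<open>0 < \<epsilon>\<close>] by blast
    moreover have "nbhd \<tau> x (seminorm_ball J \<epsilon> x)"
      using insert by simp
    ultimately show ?case
      by (subst seminorm_ball_insert) (rule nbhd_Int)
  qed
  show ?thesis
    unfolding induced_by_def
  proof (intro conjI ballI allI impI)
    show "topspace \<tau> = UNIV"
      by (rule induced_byD(1)[OF P])
  next
    fix \<rho> assume "\<rho> \<in> ?Q"
    then show "extended_seminorm smul \<rho>"
      by (auto simp: continuous_dual_def intro!: extended_seminorm_sup_seminorm[OF vs])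
  next
    fix x \<epsilon> J assume "(0::real) < \<epsilon>" "J \<subseteq> ?Q" "finite J"
    then show "nbhd \<tau> x (seminorm_ball J \<epsilon> x)"
      by (intro ball)
  next
    fix x U assume "nbhd \<tau> x U"
    from induced_byD(4)[OF P this] obtain \<epsilon> J
      where "0 < \<epsilon>" "J \<subseteq> P" "finite J" "seminorm_ball J \<epsilon> x \<subseteq> U"
      by blast
    moreover from \<open>J \<subseteq> P\<close> \<open>P \<subseteq> ?Q\<close> have "J \<subseteq> ?Q"
      by (rule order.trans)
    ultimately show "\<exists>\<epsilon>>0. \<exists>J\<subseteq>?Q. finite J \<and> seminorm_ball J \<epsilon> x \<subseteq> U"
      by (intro exI[of _ \<epsilon>] exI[of _ J] conjI)
  qed
qed

theorem theorem4p3: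
  shows "(\<forall>(smul :: real \<Rightarrow> 'a::ab_group_add \<Rightarrow> 'a) \<tau>.
            elcs smul \<tau> \<longrightarrow>
            induced_by smul \<tau>
              {sup_seminorm A | A. A \<subseteq> continuous_dual smul \<tau> \<and> equicontinuous \<tau> A}) \<and>
         (\<forall>(smul :: complex \<Rightarrow> 'a \<Rightarrow> 'a) \<tau>.
            elcs smul \<tau> \<longrightarrow>
            induced_by smul \<tau>
              {sup_seminorm A | A. A \<subseteq> continuous_dual smul \<tau> \<and> equicontinuous \<tau> A})"
proof (intro conjI allI impI)
  fix smul :: "real \<Rightarrow> 'a \<Rightarrow> 'a" and \<tau>
  assume "elcs smul \<tau>"
  then have "vector_space smul"
    by (simp add: elcs_def)
  then show "induced_by smul \<tau>
      {sup_seminorm A | A. A \<subseteq> continuous_dual smul \<tau> \<and> equicontinuous \<tau> A}"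
    using \<open>elcs smul \<tau>\<close>
    by (rule induced_by_equicontinuous_sets[OF hahn_banach_property_real])
next
  fix smul :: "complex \<Rightarrow> 'a \<Rightarrow> 'a" and \<tau>
  assume "elcs smul \<tau>"
  then have "vector_space smul"
    by (simp add: elcs_def)
  then show "induced_by smul \<tau>
      {sup_seminorm A | A. A \<subseteq> continuous_dual smul \<tau> \<and> equicontinuous \<tau> A}"
    using \<open>elcs smul \<tau>\<close>
    by (rule induced_by_equicontinuous_sets[OF hahn_banach_property_complex])
qed

end
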